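(* Let $k\geq1$, $n\geq1$ and $1\leq j\leq n$. The number of $k$-box paths of size $n$ with exactly $j$ returns is \[\grave{f}_{k,n,j}=\frac{j(k+1)-1}{(k+2)n-j-1}\binom{(k+2)n-j-1}{n-j},\] and for $j<n$ this also equals $\frac{j(k+1)-1}{n-j}\binom{(k+2)n-j-2}{n-j-1}$.
   Context: A skew Dyck path is a word $w$ over $\{U,D,L\}$ such that: $w$ contains neither $UL$ nor $LU$ as a contiguous subword; the number of $U$s equals the total number of $D$s and $L$s; and in every prefix the total number of $D$s and $L$s is at most the number of $U$s. Geometrically $U=(1,1)$, $D=(1,-1)$, $L=(-1,-1)$ starting at the origin. Its semilength is its number of $U$s. A factor is a contiguous subword; $X^{m}$ denotes $m$ consecutive copies of $X$. For $k\geq1$, a $k$-box path of size $n$ is a skew Dyck path of semilength $(k+2)n-1$ containing exactly $n$ occurrences of the factor $UD^{k}L$. A return is a point where a step of the path ends on the $x$-axis (equivalently, a nonempty prefix in which the number of $U$s equals the total number of $D$s and $L$s). *)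

theory Defs
  imports Complex_Main "HOL-Library.Sublist"
begin

datatype step = U | D | L

definition ups :: "step list \<Rightarrow> nat" where
  "ups w = count_list w U"

definition downs :: "step list \<Rightarrow> nat" where
  "downs w = count_list w D + count_list w L"

definition skew_dyck :: "step list \<Rightarrow> bool" where
  "skew_dyck w \<longleftrightarrow>
     \<not> sublist [U, L] w \<and> \<not> sublist [L, U] w \<and>
     ups w = downs w \<and> (\<forall>p. prefix p w \<longrightarrow> downs p \<le> ups p)"

definition semilength :: "step list \<Rightarrow> nat" where
  "semilength w = ups w"

text \<open>Occurrences of \<open>v\<close> as a contiguous factor of \<open>w\<close>, counted by starting position.\<close>

definition occurrences :: "'a list \<Rightarrow> 'a list \<Rightarrow> nat" where
  "occurrences v w = card {i. i \<le> length w \<and> prefix v (drop i w)}"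

definition box_path :: "nat \<Rightarrow> nat \<Rightarrow> step list \<Rightarrow> bool" where
  "box_path k n w \<longleftrightarrow>
     skew_dyck w \<and> semilength w = (k + 2) * n - 1 \<and>
     occurrences (U # replicate k D @ [L]) w = n"

definition returns :: "step list \<Rightarrow> nat" where
  "returns w = card {p. prefix p w \<and> p \<noteq> [] \<and> ups p = downs p}"

end

theory Submission
  imports Defs
begin

text \<open>
  Every down-step of a box path lies in a box \<open>U D\<^sup>k L\<close>, or is the single \<open>D\<close> that must
  separate one box from the next, because \<open>L U\<close> is forbidden. The semilength \<open>(k + 2) n - 1\<close> leaves
  room for nothing else, so a box path is a word over the code \<open>{U, U D\<^sup>k L D}\<close> followed by
  \<open>U D\<^sup>k L\<close>. Read backwards, such a word is a path from height \<open>k\<close> to height \<open>0\<close> with steps \<open>-1\<close> and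
  \<open>+(k + 1)\<close>. Its visits to \<open>0\<close> are the origin and the returns other than the last one, so their
  number is that of the returns. Splitting off the first step shows that these paths satisfy the
  recurrence of the Raney numbers.
\<close>

section \<open>Raney numbers\<close>

text \<open>The coefficient of \<open>z\<^sup>t\<close> in \<open>B\<^sup>r\<close>, where \<open>B = 1 + z B\<^bsup>m+1\<^esup>\<close>.\<close>

fun raney :: "nat \<Rightarrow> nat \<Rightarrow> nat \<Rightarrow> nat" where
  "raney m 0 r = 1"
| "raney m (Suc t) 0 = 0"
| "raney m (Suc t) (Suc r) = raney m (Suc t) r + raney m t (Suc r + m)"

text \<open>Both recursive calls of \<open>raney\<close> lead to binomials with the same upper index
  \<open>N\<close>, so Pascal's rule closes the induction. The assumption excludes
  \<open>t = r = 0\<close>, where \<open>raney\<close> is 1 but the quotient 0/0 evaluates to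
  0.\<close>

lemma raney_closed_form:
  assumes "t + r > 0"
  shows "real (raney m t r) =
    real r / real ((m + 1) * t + r) * real (((m + 1) * t + r) choose t)"
  using assms
proof (induction m t r rule: raney.induct)
  case (3 m t r)
  define N where "N = (m + 1) * Suc t + r"
  have N: "(m + 1) * Suc t + Suc r = Suc N" "(m + 1) * t + (Suc r + m) = N"
    by (simp_all add: N_def)
  have "N > 0"
    by (simp add: N_def)
  have lower: "real (Suc N) * real (N choose t) = real (Suc t) * real (Suc N choose Suc t)"
    by (metis Suc_times_binomial_eq mult.commute of_nat_mult)
  have "real (Suc N choose Suc t) = real (N choose t) + real (N choose Suc t)"
    by simp
  then have upper: "real (N choose Suc t) = real (Suc N choose Suc t) - real (N choose t)"
    by simp
  \<comment> \<open>Pascal's rule splits \<open>C\<close> into the shares \<open>q\<close> and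
    \<open>1 - q\<close>; what remains is a rational identity in \<open>r\<close>, \<open>m\<close>
    and \<open>t\<close>.\<close>
  define C q where "C = real (Suc N choose Suc t)" and "q = real (Suc t) / real (Suc N)"
  have low: "real (N choose t) = q * C"
    using lower by (simp add: C_def q_def field_simps del: binomial_Suc_Suc)
  have "real (raney m (Suc t) (Suc r)) =
      real r / real N * real (N choose Suc t) + real (Suc r + m) / real N * real (N choose t)"
  proof -
    have "real (raney m (Suc t) r) = real r / real N * real (N choose Suc t)"
      using 3(1) unfolding N_def by simp
    moreover have "real (raney m t (Suc r + m)) = real (Suc r + m) / real N * real (N choose t)"
      using 3(2) unfolding N by simp
    ultimately show ?thesis by simp
  qed
  also have "\<dots> = (real r * (1 - q) + real (Suc r + m) * q) / real N * C"
    unfolding upper low C_def[symmetric]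
    by (simp add: algebra_simps add_divide_distrib diff_divide_distrib)
  also have "(real r * (1 - q) + real (Suc r + m) * q) / real N = real (Suc r) / real (Suc N)"
  proof -
    have "real N = (real m + 1) * real (Suc t) + real r"
      by (simp add: N_def algebra_simps)
    then have "real r * (real (Suc N) - real (Suc t)) + real (Suc r + m) * real (Suc t) =
        real (Suc r) * real N"
      by (simp add: algebra_simps)
    then show ?thesis
      using \<open>N > 0\<close> by (simp add: q_def divide_simps)
  qed
  finally show ?case
    unfolding N C_def .
qed auto

section \<open>Counting weighted paths by visits to zero\<close>

text \<open>With \<open>m = k + 1\<close>, \<open>False\<close> stands for the letter
  \<open>U\<close> and \<open>True\<close> for a box with its separating \<open>D\<close>, both read
  backwards.\<close>

fun descends :: "nat \<Rightarrow> nat \<Rightarrow> bool list \<Rightarrow> bool" where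
  "descends m h [] \<longleftrightarrow> h = 0"
| "descends m h (True # r) \<longleftrightarrow> descends m (h + m) r"
| "descends m h (False # r) \<longleftrightarrow> 0 < h \<and> descends m (h - 1) r"

text \<open>Start and end points are counted too. The truncation in \<open>h - 1\<close> is harmless
  for words that satisfy \<open>descends\<close>.\<close>

fun zero_visits :: "nat \<Rightarrow> nat \<Rightarrow> bool list \<Rightarrow> nat" where
  "zero_visits m h [] = of_bool (h = 0)"
| "zero_visits m h (b # r) = of_bool (h = 0) + zero_visits m (if b then h + m else h - 1) r"

definition descents :: "nat \<Rightarrow> nat \<Rightarrow> nat \<Rightarrow> nat \<Rightarrow> bool list set" where
  "descents m s h j =
    {r. descends m h r \<and> count_list r True = s \<and> zero_visits m h r = j}"

lemma length_descends:
  "descends m h r \<Longrightarrow> length r = h + (m + 1) * count_list r True"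
  by (induction m h r rule: descends.induct) auto

lemma zero_visits_pos: "descends m h r \<Longrightarrow> zero_visits m h r > 0"
  by (induction m h r rule: descends.induct) auto

lemma finite_descents: "finite (descents m s h j)"
proof (rule finite_subset)
  show "descents m s h j \<subseteq> {r. set r \<subseteq> UNIV \<and> length r = h + (m + 1) * s}"
    using length_descends by (auto simp: descents_def)
  show "finite {r :: bool list. set r \<subseteq> UNIV \<and> length r = h + (m + 1) * s}"
    by (rule finite_lists_length_eq) simp
qed

lemma descents_no_visits: "descents m s h 0 = {}"
  using zero_visits_pos by (fastforce simp: descents_def)

lemma descents_Suc_height:
  "descents m s (Suc h) j =
    (#) False ` descents m s h j \<union>
    (case s of 0 \<Rightarrow> {} | Suc s' \<Rightarrow> (#) True ` descents m s' (Suc h + m) j)"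
  (is "?A = ?B")
proof (intro set_eqI iffI)
  fix r assume "r \<in> ?A"
  then show "r \<in> ?B"
    by (cases r; cases "hd r") (auto simp: descents_def)
qed (auto simp: descents_def split: nat.splits)

lemma descents_zero_height:
  "descents m (Suc s) 0 (Suc j) = (#) True ` descents m s m j"
  (is "?A = ?B")
proof (intro set_eqI iffI)
  fix r assume "r \<in> ?A"
  then show "r \<in> ?B"
    by (cases r; cases "hd r") (auto simp: descents_def)
qed (auto simp: descents_def)

lemma descents_trivial: "descents m 0 0 j = (if j = 1 then {[]} else {})"
proof -
  have "r = []" if "descends m 0 r" "count_list r True = 0" for r
    using length_descends[OF that(1)] that(2) by simp
  then have "descents m 0 0 j \<subseteq> {[]}"
    by (auto simp: descents_def)
  moreover have "[] \<in> descents m 0 0 j \<longleftrightarrow> j = 1"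
    by (auto simp: descents_def)
  ultimately show ?thesis
    by auto
qed

text \<open>Splitting off the first step from a positive height is the recurrence of
  \<open>raney\<close>: a descent lowers its last argument by 1, an ascent lowers \<open>s\<close>
  and raises that argument by \<open>m\<close>. At height 0 the ascent is forced and one visit is
  used up; then \<open>s\<close> and \<open>i\<close> both drop by 1 while \<open>h\<close> grows
  from 0 to \<open>m\<close>, so \<open>s - i\<close> and \<open>h + m * i\<close> stay the
  same.\<close>

lemma card_descents:
  "card (descents m s h (Suc i)) =
    (if i \<le> s then raney m (s - i) (h + m * i) else 0)"
\<comment> \<open>The measure is the common length of the paths, by
  \<open>length_descends\<close>.\<close>
proof (induction "(m + 1) * s + h" arbitrary: s h i rule: less_induct)
  case less
  show ?case
  proof (cases h)
    case 0
    show ?thesis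
    proof (cases s)
      case 0
      then show ?thesis
        using \<open>h = 0\<close> by (simp add: descents_trivial)
    next
      case (Suc s')
      have card: "card (descents m s h (Suc i)) = card (descents m s' m i)"
        using \<open>h = 0\<close> Suc by (simp add: descents_zero_height card_image)
      show ?thesis
      proof (cases i)
        case 0
        then show ?thesis
          using card \<open>h = 0\<close> Suc by (simp add: descents_no_visits)
      next
        case (Suc i')
        have "card (descents m s' m (Suc i')) =
            (if i' \<le> s' then raney m (s' - i') (m + m * i') else 0)"
          by (rule less) (simp add: \<open>s = Suc s'\<close>)
        then show ?thesis
          using card \<open>h = 0\<close> \<open>s = Suc s'\<close> Suc by simp
      qed
    qed
  next
    case (Suc h')
    have low: "card (descents m s h' (Suc i)) =
        (if i \<le> s then raney m (s - i) (h' + m * i) else 0)"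
      by (rule less) (simp add: Suc)
    show ?thesis
    proof (cases s)
      case 0
      then show ?thesis
        using low Suc by (simp add: descents_Suc_height card_image)
    next
      case (Suc s')
      have high: "card (descents m s' (Suc h' + m) (Suc i)) =
          (if i \<le> s' then raney m (s' - i) (Suc h' + m + m * i) else 0)"
        by (rule less) (simp add: Suc \<open>h = Suc h'\<close>)
      have "card (descents m s h (Suc i)) =
          card (descents m s h' (Suc i)) + card (descents m s' (Suc h' + m) (Suc i))"
        unfolding \<open>h = Suc h'\<close> Suc descents_Suc_height nat.case
        by (subst card_Un_disjoint) (auto simp: finite_descents card_image)
      moreover have "s - i = Suc (s' - i)" if "i \<le> s'"
        using that Suc by simp
      \<comment> \<open>In this boundary case no path starts with an ascent, and the descending
        branch alone gives \<open>raney m 0 _ = 1\<close>.\<close>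
      moreover have "i = s" if "i \<le> s" "\<not> i \<le> s'"
        using that Suc by simp
      ultimately show ?thesis
        using low high \<open>h = Suc h'\<close> Suc by (auto simp: ac_simps)
    qed
  qed
qed

section \<open>Box paths as words over a code\<close>

lemma ups_simps [simp]:
  "ups [] = 0" "ups (U # w) = Suc (ups w)" "ups (D # w) = ups w" "ups (L # w) = ups w"
  "ups (v @ w) = ups v + ups w" "ups (replicate i D) = 0"
  by (auto simp: ups_def)

lemma downs_simps [simp]:
  "downs [] = 0" "downs (U # w) = downs w" "downs (D # w) = Suc (downs w)"
  "downs (L # w) = Suc (downs w)" "downs (v @ w) = downs v + downs w"
  "downs (replicate i D) = i"
  by (auto simp: downs_def) (induction i, auto)

lemma ups_downs_length: "ups w + downs w = length w"
proof (induction w)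
  case (Cons x w)
  then show ?case by (cases x) auto
qed simp

lemma occurrences_Nil: "v \<noteq> [] \<Longrightarrow> occurrences v [] = 0"
  by (simp add: occurrences_def)

lemma occurrences_Cons:
  "occurrences v (x # w) = of_bool (prefix v (x # w)) + occurrences v w"
proof -
  have "{i. i \<le> length (x # w) \<and> prefix v (drop i (x # w))} =
      {i. i = 0 \<and> prefix v (x # w)} \<union> Suc ` {i. i \<le> length w \<and> prefix v (drop i w)}"
    (is "?A = ?B")
  proof (intro set_eqI iffI)
    fix i assume "i \<in> ?A"
    then show "i \<in> ?B" by (cases i) auto
  qed auto
  then have "occurrences v (x # w) =
      card ({i. i = 0 \<and> prefix v (x # w)} \<union> Suc ` {i. i \<le> length w \<and> prefix v (drop i w)})"
    by (simp only: occurrences_def)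
  also have "\<dots> = of_bool (prefix v (x # w)) + occurrences v w"
    unfolding occurrences_def
    by (subst card_Un_disjoint) (auto simp: card_image)
  finally show ?thesis .
qed

abbreviation box :: "nat \<Rightarrow> step list" where
  "box k \<equiv> U # replicate k D @ [L]"

lemma occurrences_replicate_D [simp]:
  "occurrences (box k) (replicate i D @ w) = occurrences (box k) w"
  by (induction i) (auto simp: occurrences_Cons)

lemma sublist_UL_replicate_D [simp]:
  "sublist [U, L] (replicate i D @ w) \<longleftrightarrow> sublist [U, L] w"
  by (induction i) (auto simp: sublist_Cons_right)

lemma sublist_LU_replicate_D [simp]:
  "sublist [L, U] (replicate i D @ w) \<longleftrightarrow> sublist [L, U] w"
  by (induction i) (auto simp: sublist_Cons_right)

primrec letter :: "nat \<Rightarrow> bool \<Rightarrow> step list" where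
  "letter k True = U # replicate k D @ [L, D]"
| "letter k False = [U]"

definition codeword :: "nat \<Rightarrow> bool list \<Rightarrow> step list" where
  "codeword k c = concat (map (letter k) c)"

lemma codeword_simps [simp]:
  "codeword k [] = []"
  "codeword k (b # c) = letter k b @ codeword k c"
  "codeword k (c @ d) = codeword k c @ codeword k d"
  by (simp_all add: codeword_def)

text \<open>Every letter is thus followed by a \<open>U\<close>, which is what makes decoding and
  the local factor checks work.\<close>

lemma codeword_box_eq_Cons:
  obtains w where "codeword k c @ box k = U # w"
proof (cases c)
  case (Cons b c')
  then show ?thesis using that by (cases b) auto
qed (use that in simp)

text \<open>The letter \<open>U\<close> is a prefix of the other letter, so this is no prefix code.
  One more step decides: it is \<open>U\<close> after the short letter and, as \<open>k\<close> is
  positive, \<open>D\<close> inside the long one.\<close>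

lemma codeword_box_inj:
  assumes "k \<ge> 1" "codeword k c @ box k = codeword k d @ box k"
  shows "c = d"
  using assms(2)
proof (induction c arbitrary: d)
  case Nil
  show ?case
  proof (cases d)
    case (Cons b d')
    then have "length (codeword k d @ box k) > length (box k)"
      by (cases b) auto
    then show ?thesis using Nil by (metis codeword_simps(1) append_Nil less_irrefl)
  qed simp
next
  case (Cons a c)
  obtain k' where k: "k = Suc k'"
    using assms(1) by (cases k) auto
  show ?case
  proof (cases d)
    case Nil
    have "length (codeword k (a # c) @ box k) > length (box k)"
      by (cases a) auto
    then show ?thesis using Cons.prems Nil by (metis codeword_simps(1) append_Nil less_irrefl)
  next
    case (Cons b d')
    obtain v w where "codeword k c @ box k = U # v" "codeword k d' @ box k = U # w"
      by (meson codeword_box_eq_Cons)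
    then have "a = b"
      using Cons.prems Cons by (cases a; cases b) (auto simp: k)
    then show ?thesis
      using Cons.prems Cons.IH[of d'] Cons by simp
  qed
qed

text \<open>A single-step letter starts no box, because the next step is \<open>U\<close> and not
  \<open>D\<close>; the extra 1 is the final box.\<close>

lemma occurrences_codeword_box:
  assumes "k \<ge> 1"
  shows "occurrences (box k) (codeword k c @ box k) = Suc (count_list c True)"
proof (induction c)
  case Nil
  have "occurrences (box k) [L] = 0"
    by (simp add: occurrences_Cons occurrences_Nil)
  then show ?case
    by (simp add: occurrences_Cons)
next
  case (Cons b c)
  obtain k' where k: "k = Suc k'"
    using assms(1) by (cases k) auto
  obtain w where w: "codeword k c @ box k = U # w"
    by (rule codeword_box_eq_Cons)
  show ?case
  proof (cases b)
    case True
    have "occurrences (box k) (codeword k (b # c) @ box k) =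
        Suc (occurrences (box k) (replicate k D @ L # D # codeword k c @ box k))"
      using True by (simp add: occurrences_Cons prefix_def)
    also have "\<dots> = Suc (occurrences (box k) (codeword k c @ box k))"
      by (simp add: occurrences_Cons)
    finally show ?thesis
      using Cons True by simp
  next
    case False
    then have "occurrences (box k) (codeword k (b # c) @ box k) =
        occurrences (box k) (codeword k c @ box k)"
      unfolding codeword_simps letter.simps append.simps append_Nil append_assoc
      by (simp add: occurrences_Cons w) (simp add: k w)
    then show ?thesis
      using Cons False by simp
  qed
qed

lemma codeword_box_no_UL_LU:
  assumes "k \<ge> 1"
  shows "\<not> sublist [U, L] (codeword k c @ box k) \<and> \<not> sublist [L, U] (codeword k c @ box k)"
proof (induction c)
  case Nil
  obtain k' where "k = Suc k'"
    using assms(1) by (cases k) auto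
  then show ?case
    by (simp add: sublist_Cons_right)
next
  case (Cons b c)
  obtain k' where k: "k = Suc k'"
    using assms(1) by (cases k) auto
  obtain w where w: "codeword k c @ box k = U # w"
    by (rule codeword_box_eq_Cons)
  with Cons have IH: "\<not> sublist [U, L] (U # w)" "\<not> sublist [L, U] (U # w)"
    by simp_all
  have "codeword k (b # c) @ box k = letter k b @ U # w"
    using w by simp
  then show ?case
    using IH by (cases b) (simp_all add: sublist_Cons_right k)
qed

text \<open>A box uses \<open>k + 1\<close> down-steps, and unless it ends the word one more must
  follow it, since \<open>L U\<close> is forbidden. Equality leaves no other down-step. For box
  paths the semilength condition is exactly this equality.\<close>

lemma box_count_bound:
  assumes "\<not> sublist [L, U] w"
  shows "(k + 2) * occurrences (box k) w \<le> Suc (downs w) \<and>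
    (Suc (downs w) = (k + 2) * occurrences (box k) w \<longrightarrow>
      (\<exists>c. w = codeword k c @ box k))"
  using assms
proof (induction w rule: length_induct)
  case (1 w)
  have IH: "(k + 2) * occurrences (box k) v \<le> Suc (downs v)"
      "Suc (downs v) = (k + 2) * occurrences (box k) v \<Longrightarrow> \<exists>c. v = codeword k c @ box k"
    if "length v < length w" "\<not> sublist [L, U] v" for v
    using 1 that by blast+
  show ?case
  proof (cases "prefix (box k) w")
    case True
    then obtain v where w: "w = U # replicate k D @ L # v"
      by (auto simp: prefix_def)
    have occ: "occurrences (box k) w = Suc (occurrences (box k) v)"
      using True by (simp add: w occurrences_Cons)
    have LU: "\<not> sublist [L, U] (L # v)"
      using 1(2) by (simp add: w sublist_Cons_right)
    show ?thesis
    proof (cases v)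
      case Nil
      then have "w = codeword k [] @ box k"
        by (simp add: w)
      then show ?thesis
        using occ Nil by (auto simp: w occurrences_Nil simp del: codeword_simps)
    next
      case (Cons x u)
      have u: "length u < length w" "\<not> sublist [L, U] u"
        using LU by (simp_all add: w Cons sublist_Cons_right)
      have "x \<noteq> U"
        using LU Cons by (auto simp: sublist_Cons_right)
      \<comment> \<open>Whether \<open>x\<close> is \<open>D\<close> or \<open>L\<close>, no box
        starts there, so the box and \<open>x\<close> can be removed together.\<close>
      then have occ': "occurrences (box k) w = Suc (occurrences (box k) u)"
          and downs: "downs w = k + 2 + downs u"
        using occ Cons by (cases x; simp add: occurrences_Cons w)+
      show ?thesis
      proof (intro conjI impI)
        show "(k + 2) * occurrences (box k) w \<le> Suc (downs w)"
          using IH(1)[OF u] occ' downs by simp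
        assume "Suc (downs w) = (k + 2) * occurrences (box k) w"
        then have "Suc (downs u) = (k + 2) * occurrences (box k) u"
          using occ' downs by simp
        then obtain c where c: "u = codeword k c @ box k"
          using IH(2)[OF u] by blast
        then obtain u' where "u = U # u'"
          using codeword_box_eq_Cons by metis
        \<comment> \<open>In the equality case the rest is a codeword followed by a box and starts
          with \<open>U\<close>, so \<open>x = L\<close> would create \<open>L U\<close>.\<close>
        then have "x \<noteq> L"
          using LU Cons by (auto simp: sublist_Cons_right)
        then have "x = D"
          using \<open>x \<noteq> U\<close> by (cases x) auto
        then have "w = codeword k (True # c) @ box k"
          by (simp add: w Cons c)
        then show "\<exists>c. w = codeword k c @ box k" ..
      qed
    qed
  next
    case False
    show ?thesis
    proof (cases w)
      case Nil
      then show ?thesis by (simp add: occurrences_Nil)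
    next
      case (Cons x v)
      have v: "length v < length w" "\<not> sublist [L, U] v"
        using 1(2) by (simp_all add: Cons sublist_Cons_right)
      have occ: "occurrences (box k) w = occurrences (box k) v"
        using False by (simp add: Cons occurrences_Cons)
      show ?thesis
      proof (cases "x = U")
        case True
        have "\<exists>c. w = codeword k c @ box k" if "v = codeword k c @ box k" for c
          using that by (intro exI[of _ "False # c"]) (simp add: Cons True)
        then show ?thesis
          using IH[OF v] occ Cons True by auto
      next
        case False
        \<comment> \<open>A down-step outside this scheme raises only the right-hand side, so the
          bound is strict and equality is impossible.\<close>
        then have "downs w = Suc (downs v)"
          using Cons by (cases x) auto
        then show ?thesis
          using IH(1)[OF v] occ by simp
      qed
    qed
  qed
qed

section \<open>Prefixes and returns\<close>

definition nonnegative :: "step list \<Rightarrow> bool" where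
  "nonnegative w \<longleftrightarrow> (\<forall>p. prefix p w \<longrightarrow> downs p \<le> ups p)"

text \<open>The empty prefix is included, to match the visits to 0 of the reversed path.\<close>

definition balanced_prefixes :: "step list \<Rightarrow> step list set" where
  "balanced_prefixes w = {p. prefix p w \<and> ups p = downs p}"

lemma finite_balanced_prefixes: "finite (balanced_prefixes w)"
  by (rule finite_subset[of _ "set (prefixes w)"]) (auto simp: balanced_prefixes_def)

lemma card_balanced_prefixes: "card (balanced_prefixes w) = Suc (returns w)"
proof -
  have "balanced_prefixes w = insert [] {p. prefix p w \<and> p \<noteq> [] \<and> ups p = downs p}"
    by (auto simp: balanced_prefixes_def)
  moreover have "finite {p. prefix p w \<and> p \<noteq> [] \<and> ups p = downs p}"
    by (rule finite_subset[OF _ finite_balanced_prefixes[of w]])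
      (auto simp: balanced_prefixes_def)
  ultimately show ?thesis
    by (simp add: returns_def)
qed

text \<open>After its only \<open>U\<close> the block just falls, so its lowest point past the start
  is its end and is reached only there.\<close>

lemma prefix_peak:
  assumes "ups v = 0" "prefix p (U # v)" "p \<noteq> []"
  shows "ups p = 1" "downs p \<le> downs v" "downs p = downs v \<longleftrightarrow> p = U # v"
proof -
  obtain p' q where "p = U # p'" "v = p' @ q"
    using assms(2,3) by (cases p) (auto simp: prefix_def)
  moreover have "ups q + downs q = length q"
    by (rule ups_downs_length)
  ultimately show "ups p = 1" "downs p \<le> downs v" "downs p = downs v \<longleftrightarrow> p = U # v"
    using assms(1) by auto
qed

text \<open>Here \<open>h\<close> is the final height of \<open>u @ U # v\<close>; no earlier point of the peak \<open>U # v\<close> is as low.\<close>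

lemma nonnegative_append_peak:
  assumes "ups v = 0" "ups u + 1 = downs u + downs v + h"
  shows "nonnegative (u @ U # v) \<longleftrightarrow> nonnegative u"
proof -
  have "downs (u @ p) \<le> ups (u @ p)" if "prefix p (U # v)" "p \<noteq> []" for p
    using prefix_peak[OF assms(1) that] assms(2) by simp
  then show ?thesis
    unfolding nonnegative_def prefix_append by (metis append_Nil2 prefix_order.refl)
qed

text \<open>Inside the peak the path stays above its final height \<open>h\<close>, so only its end
  can lie on the axis.\<close>

lemma card_balanced_prefixes_append_peak:
  assumes "ups v = 0" "ups u + 1 = downs u + downs v + h"
  shows "card (balanced_prefixes (u @ U # v)) = card (balanced_prefixes u) + of_bool (h = 0)"
proof -
  have iff: "ups (u @ p) = downs (u @ p) \<longleftrightarrow> p = U # v \<and> h = 0"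
    if "prefix p (U # v)" "p \<noteq> []" for p
    using prefix_peak[OF assms(1) that] assms(2) by auto
  have "balanced_prefixes (u @ U # v) =
      balanced_prefixes u \<union> {p. p = u @ U # v \<and> h = 0}"
  proof (intro set_eqI iffI)
    fix p assume "p \<in> balanced_prefixes (u @ U # v)"
    then show "p \<in> balanced_prefixes u \<union> {p. p = u @ U # v \<and> h = 0}"
      using iff unfolding balanced_prefixes_def prefix_append by fastforce
  next
    fix p assume "p \<in> balanced_prefixes u \<union> {p. p = u @ U # v \<and> h = 0}"
    then show "p \<in> balanced_prefixes (u @ U # v)"
      using assms unfolding balanced_prefixes_def prefix_append by auto
  qed
  moreover have "u @ U # v \<notin> balanced_prefixes u"
    by (auto simp: balanced_prefixes_def dest: prefix_length_le)
  ultimately show ?thesis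
    by (cases "h = 0") (auto simp: finite_balanced_prefixes)
qed

lemma letter_eq_peak:
  obtains v where "letter k b = U # v" "ups v = 0" "downs v = (if b then k + 2 else 0)"
  by (cases b) (auto intro: that)

text \<open>Each letter is a peak, so only heights at letter boundaries matter. The first step of
  \<open>r\<close> undoes the last letter.\<close>

lemma nonnegative_codeword_iff:
  assumes "ups (codeword k (rev r)) = downs (codeword k (rev r)) + h"
  shows "nonnegative (codeword k (rev r)) \<longleftrightarrow> descends (k + 1) h r"
  using assms
proof (induction r arbitrary: h)
  case Nil
  then show ?case
    by (simp add: nonnegative_def)
next
  case (Cons b r)
  let ?u = "codeword k (rev r)"
  obtain v where v: "letter k b = U # v" "ups v = 0" "downs v = (if b then k + 2 else 0)"
    by (rule letter_eq_peak)
  have eq: "ups ?u + 1 = downs ?u + downs v + h"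
    using Cons.prems v by simp
  have "nonnegative (codeword k (rev (b # r))) \<longleftrightarrow> nonnegative ?u"
    using nonnegative_append_peak[OF v(2) eq] v by simp
  also have "\<dots> \<longleftrightarrow> descends (k + 1) h (b # r)"
  proof (cases b)
    case True
    have "ups ?u = downs ?u + (h + (k + 1))"
      using eq v True by simp
    from Cons.IH[OF this] True show ?thesis by simp
  next
    case False
    show ?thesis
    proof (cases "h = 0")
      case True
      \<comment> \<open>A last letter \<open>U\<close> ending at height 0 starts at height -1, so
        \<open>?u\<close> itself is a prefix below the axis.\<close>
      then have "downs ?u > ups ?u"
        using eq v False by simp
      then show ?thesis
        using True False by (force simp: nonnegative_def)
    next
      case h: False
      have "ups ?u = downs ?u + (h - 1)"
        using eq v False h by simp
      from Cons.IH[OF this] False h show ?thesis by simp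
    qed
  qed
  finally show ?case .
qed

lemma descends_height:
  "descends (k + 1) h r \<Longrightarrow> ups (codeword k (rev r)) = downs (codeword k (rev r)) + h"
  by (induction "k + 1" h r rule: descends.induct) auto

lemma card_balanced_prefixes_codeword:
  assumes "descends (k + 1) h r"
  shows "card (balanced_prefixes (codeword k (rev r))) = zero_visits (k + 1) h r"
  using assms
proof (induction r arbitrary: h)
  case Nil
  then show ?case
    by (simp add: balanced_prefixes_def conj_commute cong: conj_cong)
next
  case (Cons b r)
  let ?u = "codeword k (rev r)" and ?h = "if b then h + (k + 1) else h - 1"
  obtain v where v: "letter k b = U # v" "ups v = 0" "downs v = (if b then k + 2 else 0)"
    by (rule letter_eq_peak)
  have eq: "ups ?u + 1 = downs ?u + downs v + h"
    using descends_height[OF Cons.prems] v by simp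
  have "descends (k + 1) ?h r"
    using Cons.prems by (cases b) auto
  from Cons.IH[OF this] show ?case
    using card_balanced_prefixes_append_peak[OF v(2) eq] v by simp
qed

text \<open>The final box has net height change \<open>-k\<close>, which is where the starting
  height \<open>k\<close> of the reversed path comes from.\<close>

lemma nonnegative_codeword_box_iff:
  assumes "ups (codeword k (rev r) @ box k) = downs (codeword k (rev r) @ box k)"
  shows "nonnegative (codeword k (rev r) @ box k) \<longleftrightarrow> descends (k + 1) k r"
proof -
  have "nonnegative (codeword k (rev r) @ box k) \<longleftrightarrow> nonnegative (codeword k (rev r))"
    by (rule nonnegative_append_peak[where h = 0]) (use assms in simp_all)
  then show ?thesis
    using nonnegative_codeword_iff assms by simp
qed

text \<open>Two corrections cancel: the origin is a balanced prefix but not a return, and the return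
  at the end of the final box is not a point of the reversed path.\<close>

lemma returns_codeword_box:
  assumes "descends (k + 1) k r"
  shows "returns (codeword k (rev r) @ box k) = zero_visits (k + 1) k r"
proof -
  have "card (balanced_prefixes (codeword k (rev r) @ box k)) =
      card (balanced_prefixes (codeword k (rev r))) + of_bool (0 = (0 :: nat))"
    by (rule card_balanced_prefixes_append_peak) (use descends_height[OF assms] in simp_all)
  then show ?thesis
    using card_balanced_prefixes_codeword[OF assms]
    by (simp add: card_balanced_prefixes)
qed

section \<open>The bijection with reversed paths and the final count\<close>

lemma downs_codeword: "downs (codeword k c) = (k + 2) * count_list c True"
proof (induction c)
  case (Cons b c)
  then show ?case by (cases b) simp_all
qed simp

lemma box_paths_eq_image_descents:
  assumes "k \<ge> 1" "n \<ge> 1"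
  shows "{w. box_path k n w \<and> returns w = j} =
    (\<lambda>r. codeword k (rev r) @ box k) ` descents (k + 1) (n - 1) k j"
proof (intro set_eqI iffI)
  fix w assume "w \<in> {w. box_path k n w \<and> returns w = j}"
  then have w: "\<not> sublist [L, U] w" "ups w = downs w" "nonnegative w"
      "ups w = (k + 2) * n - 1" "occurrences (box k) w = n" "returns w = j"
    by (auto simp: box_path_def skew_dyck_def semilength_def nonnegative_def)
  \<comment> \<open>Since \<open>n\<close> is positive, the subtraction in the semilength is not
    truncated, and the equality case of \<open>box_count_bound\<close> applies.\<close>
  have "Suc (downs w) = (k + 2) * occurrences (box k) w"
    using w assms(2) by simp
  then obtain c where "w = codeword k c @ box k"
    using box_count_bound[OF w(1)] by blast
  then have eq: "w = codeword k (rev (rev c)) @ box k"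
    by simp
  have desc: "descends (k + 1) k (rev c)"
    using nonnegative_codeword_box_iff[of k "rev c"] w eq by metis
  have "count_list (rev c) True = n - 1"
    using occurrences_codeword_box[OF assms(1), of c] w(5) eq by simp
  then have "rev c \<in> descents (k + 1) (n - 1) k j"
    using desc returns_codeword_box[OF desc] w(6) eq by (simp add: descents_def)
  then show "w \<in> (\<lambda>r. codeword k (rev r) @ box k) ` descents (k + 1) (n - 1) k j"
    using eq by blast
next
  fix w assume "w \<in> (\<lambda>r. codeword k (rev r) @ box k) ` descents (k + 1) (n - 1) k j"
  then obtain r where w: "w = codeword k (rev r) @ box k"
    and r: "descends (k + 1) k r" "count_list r True = n - 1" "zero_visits (k + 1) k r = j"
    by (auto simp: descents_def)
  obtain n' where n: "n = Suc n'"
    using assms(2) by (cases n) auto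
  have bal: "ups w = downs w"
    using descends_height[OF r(1)] by (simp add: w)
  then have "nonnegative w"
    using nonnegative_codeword_box_iff r(1) w by blast
  moreover have "downs w = (k + 2) * n - 1"
    using r(2) by (simp add: w downs_codeword n)
  ultimately show "w \<in> {w. box_path k n w \<and> returns w = j}"
    using bal codeword_box_no_UL_LU[OF assms(1), of "rev r"]
      occurrences_codeword_box[OF assms(1), of "rev r"] returns_codeword_box[OF r(1)] r(2,3) n
    by (simp add: w box_path_def skew_dyck_def semilength_def nonnegative_def)
qed

text \<open>This is \<open>card_descents\<close> with \<open>h = k\<close>,
  \<open>m = k + 1\<close>, \<open>s = n - 1\<close> and \<open>i = j - 1\<close>, where
  \<open>k + (k + 1) * (j - 1) = j * (k + 1) - 1\<close>.\<close>

lemma card_box_paths: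
  assumes "k \<ge> 1" "1 \<le> j" "j \<le> n"
  shows "card {w. box_path k n w \<and> returns w = j} = raney (k + 1) (n - j) (j * (k + 1) - 1)"
proof -
  have "inj (\<lambda>r. codeword k (rev r) @ box k)"
    by (rule injI) (use codeword_box_inj[OF assms(1)] in fastforce)
  then have "card {w. box_path k n w \<and> returns w = j} = card (descents (k + 1) (n - 1) k j)"
    using assms by (simp add: box_paths_eq_image_descents card_image inj_on_subset)
  also obtain i where "j = Suc i"
    using assms(2) by (cases j) auto
  then have "card (descents (k + 1) (n - 1) k j) = raney (k + 1) (n - j) (j * (k + 1) - 1)"
    using assms card_descents[of "k + 1" "n - 1" k i] by (simp add: algebra_simps)
  finally show ?thesis .
qed

theorem theorem6p2:
  fixes k n j :: nat
  assumes "k \<ge> 1" and "n \<ge> 1" and "1 \<le> j" and "j \<le> n"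
  shows "real (card {w. box_path k n w \<and> returns w = j}) =
           (real j * (real k + 1) - 1) / ((real k + 2) * real n - real j - 1) *
           real (((k + 2) * n - j - 1) choose (n - j))
       \<and> (j < n \<longrightarrow>
         real (card {w. box_path k n w \<and> returns w = j}) =
           (real j * (real k + 1) - 1) / (real n - real j) *
           real (((k + 2) * n - j - 2) choose (n - j - 1)))"
proof -
  define N where "N = (k + 2) * n - j - 1"
  define r where "r = j * (k + 1) - 1"
  \<comment> \<open>Hence \<open>r\<close> is positive, so the closed form applies even for
    \<open>j = n\<close>, and \<open>N\<close> is positive too.\<close>
  have pos: "2 \<le> j * (k + 1)"
    using mult_le_mono[of 1 j 2 "k + 1"] assms by simp
  then have r: "r > 0" "real r = real j * (real k + 1) - 1"
    by (simp_all add: r_def of_nat_diff algebra_simps)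
  obtain d where d: "n = j + d"
    using assms(4) le_Suc_ex by blast
  have N: "(k + 1 + 1) * (n - j) + r = N"
    using pos by (simp add: d r_def N_def algebra_simps)
  have "real N = (real k + 2) * real n - real j - 1"
    unfolding N[symmetric] by (simp add: r(2) d algebra_simps)
  moreover have count: "real (card {w. box_path k n w \<and> returns w = j}) =
      real r / real N * real (N choose (n - j))"
    using raney_closed_form[of "n - j" r "k + 1"] r(1)
    unfolding card_box_paths[OF assms(1,3,4)] N r_def[symmetric] by simp
  moreover have "real r / real N * real (N choose (n - j)) =
      real r / real (n - j) * real ((N - 1) choose (n - j - 1))" if "j < n"
  proof -
    \<comment> \<open>Absorption trades the denominator \<open>N\<close> for
      \<open>n - j\<close>.\<close>
    have "(n - j) * (N choose (n - j)) = N * ((N - 1) choose (n - j - 1))"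
      using that times_binomial_minus1_eq by simp
    then have "real (n - j) * real (N choose (n - j)) =
        real N * real ((N - 1) choose (n - j - 1))"
      by (metis of_nat_mult)
    moreover have "N > 0"
      using N r(1) by linarith
    ultimately show ?thesis
      using that by (simp add: field_simps)
  qed
  moreover have "N - 1 = (k + 2) * n - j - 2"
    by (simp add: N_def)
  ultimately show ?thesis
    using assms(4) unfolding r(2) N_def by (simp add: of_nat_diff)
qed

end
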